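(* Let \(\lambda\) be a regular cardinal with \(2^{<\lambda} = \lambda\). If some cardinal \(\delta \leq \lambda\) is \(\lambda\)-strongly compact, then \(\diamondsuit(\lambda)\) holds.
   Context: A cardinal \(\delta\) is \(\lambda\)-strongly compact if there is a \(\delta\)-complete fine ultrafilter on \(P_\delta(\lambda)\) (equivalently, every \(\delta\)-complete filter generated by at most \(\lambda\) sets extends to a \(\delta\)-complete ultrafilter). \(\diamondsuit(\lambda)\) is the statement that there is a sequence \(\langle S_\alpha : \alpha < \lambda\rangle\) with \(S_\alpha \subseteq \alpha\) such that for every \(A \subseteq \lambda\), the set \(\{\alpha < \lambda : A \cap \alpha = S_\alpha\}\) is stationary in \(\lambda\).
   Formalization: The formal theorem requires δ to be uncountable (the usual large-cardinal convention); with δ = ω allowed the claim fails, since for λ = δ = ω the hypotheses hold but ◇(ω) is false. *)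

theory Defs
  imports Complex_Main
begin

text \<open>
  A cardinal is a relation \<^term>\<open>r\<close> with \<^term>\<open>Card_order r\<close>: an initial
  ordinal, whose smaller ordinals are the elements of \<^term>\<open>Field r\<close>. The ordinal
  \<open>\<alpha> < r\<close>, seen as the set of its predecessors, is \<^term>\<open>underS r \<alpha>\<close>.
\<close>

unbundle cardinal_syntax


subsection \<open>Weak powers\<close>

text \<open>
  It is enough to compare \<open>s\<close> with upper bounds \<open>m\<close> on its own type, because a cardinal
  strictly below \<open>s\<close> has an isomorphic copy on that type. Similarly the \<open>k\<close> in
  \<open>weak_powers_of_two l\<close> cover all cardinals below \<open>l\<close>.
\<close>

definition is_card_sup :: "'x rel set \<Rightarrow> 'a rel \<Rightarrow> bool" where
  "is_card_sup K s \<longleftrightarrow>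
     Card_order s \<and> (\<forall>k\<in>K. k \<le>o s) \<and>
     (\<forall>m :: 'a rel. Card_order m \<and> (\<forall>k\<in>K. k \<le>o m) \<longrightarrow> s \<le>o m)"

definition weak_powers_of_two :: "'a rel \<Rightarrow> ('a \<Rightarrow> bool) rel set" where
  "weak_powers_of_two l =
     {ctwo ^c k | k :: 'a rel. Card_order k \<and> k <o l}"


subsection \<open>Strong compactness\<close>

definition P_less :: "'d rel \<Rightarrow> 'a rel \<Rightarrow> 'a set set" where
  "P_less d l = {\<sigma>. \<sigma> \<subseteq> Field l \<and> |\<sigma>| <o d}"

text \<open>\<open>U \<le> principal X\<close> says that \<open>X\<close> is a member of \<open>U\<close>.\<close>

definition ultrafilter_on :: "'x set \<Rightarrow> 'x filter \<Rightarrow> bool" where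
  "ultrafilter_on X U \<longleftrightarrow>
     U \<le> principal X \<and> U \<noteq> bot \<and>
     (\<forall>P. eventually P U \<or> eventually (\<lambda>x. \<not> P x) U)"

definition complete_filter :: "'d rel \<Rightarrow> 'x filter \<Rightarrow> bool" where
  "complete_filter d U \<longleftrightarrow>
     (\<forall>\<A> :: 'x set set. |\<A>| <o d \<and> (\<forall>A\<in>\<A>. eventually (\<lambda>x. x \<in> A) U)
        \<longrightarrow> eventually (\<lambda>x. x \<in> \<Inter>\<A>) U)"

definition fine_filter :: "'a rel \<Rightarrow> 'a set filter \<Rightarrow> bool" where
  "fine_filter l U \<longleftrightarrow> (\<forall>\<alpha>\<in>Field l. eventually (\<lambda>\<sigma>. \<alpha> \<in> \<sigma>) U)"

text \<open>
  As usual for large cardinals, \<open>d\<close> is required to be uncountable: for every infinite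
  \<open>l\<close> there is an \<open>\<omega>\<close>-complete fine ultrafilter on the finite subsets of \<open>l\<close>.
\<close>

definition strongly_compact_upto :: "'a rel \<Rightarrow> 'd rel \<Rightarrow> bool" where
  "strongly_compact_upto l d \<longleftrightarrow>
     natLeq <o d \<and>
     (\<exists>U. ultrafilter_on (P_less d l) U \<and> complete_filter d U \<and> fine_filter l U)"


subsection \<open>Stationary sets and the diamond principle\<close>

text \<open>
  \<open>cofinal\<close> is strict, so the condition below only concerns limit points \<open>\<beta>\<close> of \<open>C\<close>:
  a nonempty \<open>underS l \<beta>\<close> in which \<open>C\<close> is strictly unbounded makes \<open>\<beta>\<close> a limit ordinal.
\<close>

definition closed_in :: "'a rel \<Rightarrow> 'a set \<Rightarrow> bool" where
  "closed_in l C \<longleftrightarrow>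
     (\<forall>\<beta>\<in>Field l. underS l \<beta> \<noteq> {} \<and>
        (\<forall>\<alpha>\<in>underS l \<beta>. \<exists>\<gamma>\<in>C \<inter> underS l \<beta>. \<alpha> \<in> underS l \<gamma>) \<longrightarrow> \<beta> \<in> C)"

definition club :: "'a rel \<Rightarrow> 'a set \<Rightarrow> bool" where
  "club l C \<longleftrightarrow> C \<subseteq> Field l \<and> cofinal C l \<and> closed_in l C"

definition stationary :: "'a rel \<Rightarrow> 'a set \<Rightarrow> bool" where
  "stationary l S \<longleftrightarrow> S \<subseteq> Field l \<and> (\<forall>C. club l C \<longrightarrow> S \<inter> C \<noteq> {})"

definition diamond :: "'a rel \<Rightarrow> bool" where
  "diamond l \<longleftrightarrow>
     (\<exists>S :: 'a \<Rightarrow> 'a set. (\<forall>\<alpha>\<in>Field l. S \<alpha> \<subseteq> underS l \<alpha>) \<and>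
        (\<forall>A \<subseteq> Field l. stationary l {\<alpha> \<in> Field l. A \<inter> underS l \<alpha> = S \<alpha>}))"

end

theory Submission
  imports Defs
begin

text \<open>
  Let \<open>U\<close> be a \<open>\<delta>\<close>-complete fine ultrafilter on \<open>P\<^sub>\<delta>(\<lambda>)\<close>, with ultrapower embedding \<open>j\<close>. The
  ultrafilter \<open>W\<close> on \<open>\<lambda>\<close> derived from \<open>sup j[\<lambda>]\<close> contains all clubs. If \<open>W\<close> is \<open>\<lambda>\<close>-complete, it is
  normal and Jensen's construction of a diamond sequence on a measurable cardinal works. Otherwise
  let \<open>\<kappa> < \<lambda>\<close> be its degree of completeness; then \<open>\<delta> \<le> \<kappa>\<close> and \<open>\<kappa>\<close> is a strong limit. Because
  \<open>2\<^sup>\<mu> \<le> \<lambda>\<close> for \<open>\<mu> < \<lambda>\<close>, the bounded subsets of \<open>\<lambda>\<close> are coded by ordinals below \<open>\<lambda>\<close>.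
  Fineness yields, for almost all \<open>a < \<lambda>\<close>, fewer than \<open>\<delta>\<close> codes such that, for each \<open>A\<close> and almost all \<open>a\<close>, the set \<open>A \<inter> a\<close> is a
  union of sets with these codes. So there are at most \<open>\<kappa>\<close> guesses at \<open>a\<close>, and Kunen's argument
  reduces them to one.
\<close>

subsection \<open>Regular cardinals\<close>

text \<open>The weak powers range over cardinals on the type of \<open>lam\<close> only, so
  \<open>Y\<close> is first replaced by an equinumerous subset of \<open>Field lam\<close>.\<close>

lemma card_of_Pow_ordLeq_weak_power_sup:
  fixes lam :: "'a rel" and Y :: "'b set"
  assumes lam: "Card_order lam" and sup: "is_card_sup (weak_powers_of_two lam) lam"
    and Y: "|Y| <o lam"
  shows "|Pow Y| \<le>o lam"
proof -
  have "|Y| <o |Field lam|"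
    using Y lam card_of_Field_ordIso ordIso_symmetric ordLess_ordIso_trans by blast
  then obtain Z :: "'a set" where Z: "Z \<subseteq> Field lam" "|Y| =o |Z|"
    using internalize_card_of_ordLeq2[of Y "Field lam"] ordLess_imp_ordLeq by blast
  have "|Z| <o lam"
    using Z(2) Y ordIso_ordLess_trans ordIso_symmetric by blast
  then have "ctwo ^c |Z| \<in> weak_powers_of_two lam"
    unfolding weak_powers_of_two_def using card_of_Card_order by blast
  then have Z_le: "ctwo ^c |Z| \<le>o lam"
    using sup unfolding is_card_sup_def by blast
  have "|Pow Y| =o ctwo ^c |Y|"
    using card_of_Pow_Func by (simp add: cexp_def ctwo_def Field_card_of)
  moreover have "ctwo ^c |Y| =o ctwo ^c |Z|"
    by (rule cexp_cong2[OF Z(2) Card_order_ctwo card_of_Card_order])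
  ultimately show ?thesis
    using Z_le ordIso_transitive ordIso_ordLeq_trans by blast
qed

section \<open>Order, strict bounds and coding in a regular cardinal\<close>

locale regular_cardinal =
  fixes lam :: "'a rel"
  assumes card: "Card_order lam" and inf: "cinfinite lam" and reg: "regularCard lam"
begin

abbreviation below :: "'a \<Rightarrow> 'a \<Rightarrow> bool"  (infix \<open>\<prec>\<close> 50) where
  "a \<prec> b \<equiv> a \<in> underS lam b"

lemma Well_order: "Well_order lam"
  using card unfolding card_order_on_def by blast

lemma below_iff: "a \<prec> b \<longleftrightarrow> a \<noteq> b \<and> (a, b) \<in> lam"
  unfolding underS_def by blast

lemma below_Field: "a \<prec> b \<Longrightarrow> a \<in> Field lam" "a \<prec> b \<Longrightarrow> b \<in> Field lam"
  unfolding below_iff Field_def by blast+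

lemma trans_lam: "trans lam" and antisym_lam: "antisym lam"
  using Well_order unfolding order_on_defs by blast+

lemma below_trans: "a \<prec> b \<Longrightarrow> b \<prec> c \<Longrightarrow> a \<prec> c"
  and le_below_trans: "(a, b) \<in> lam \<Longrightarrow> b \<prec> c \<Longrightarrow> a \<prec> c"
  unfolding below_iff using trans_lam antisym_lam unfolding trans_def antisym_def by blast+

lemma below_irrefl: "\<not> a \<prec> a"
  by (simp add: below_iff)

lemma below_asym: "a \<prec> b \<Longrightarrow> \<not> b \<prec> a"
  using below_trans below_irrefl by blast

lemma not_below:
  assumes "a \<in> Field lam" and "b \<in> Field lam" and "\<not> a \<prec> b"
  shows "(b, a) \<in> lam"
proof -
  have "total_on (Field lam) lam" and "(a, a) \<in> lam"
    using Well_order assms(1) unfolding order_on_defs by (auto dest: refl_onD)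
  then show ?thesis
    using assms unfolding below_iff total_on_def by metis
qed

lemma below_linear: "a \<in> Field lam \<Longrightarrow> b \<in> Field lam \<Longrightarrow> a \<prec> b \<or> a = b \<or> b \<prec> a"
  using not_below by (auto simp: below_iff)

lemma below_imp_le: "a \<prec> b \<Longrightarrow> (a, b) \<in> lam"
  by (simp add: below_iff)

lemma wf_below: "wf {(a, b). a \<prec> b}"
proof -
  have "{(a, b). a \<prec> b} = lam - Id"
    by (auto simp: below_iff)
  then show ?thesis
    using Well_order unfolding well_order_on_def by simp
qed

lemma infinite_Field: "infinite (Field lam)"
  using inf unfolding cinfinite_def .

lemma ex_above: "a \<in> Field lam \<Longrightarrow> \<exists>b. a \<prec> b"
  using infinite_Card_order_limit[OF card infinite_Field] by (auto simp: below_iff)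

lemma ex_bound:
  assumes "K \<subseteq> Field lam" and "|K| <o lam"
  obtains b where "b \<in> Field lam" and "\<And>k. k \<in> K \<Longrightarrow> k \<prec> b"
proof -
  have "\<not> cofinal K lam"
    using reg assms not_ordLess_ordIso unfolding regularCard_def by blast
  then obtain a where a: "a \<in> Field lam" "\<And>k. k \<in> K \<Longrightarrow> \<not> a \<prec> k"
    unfolding cofinal_def below_iff by blast
  \<comment> \<open>Non-cofinality only puts \<open>K\<close> weakly below \<open>a\<close>; one
    step further up makes the bound strict.\<close>
  obtain b where "a \<prec> b"
    using ex_above a(1) by blast
  moreover have "(k, a) \<in> lam" if "k \<in> K" for k
    using a that assms(1) not_below by blast
  ultimately show ?thesis
    using that le_below_trans below_Field by blast
qed

lemma ex_image_bound:
  assumes "|I| <o lam" and "\<And>i. i \<in> I \<Longrightarrow> g i \<in> Field lam"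
  obtains b where "b \<in> Field lam" and "\<And>i. i \<in> I \<Longrightarrow> g i \<prec> b"
proof -
  have "|g ` I| <o lam"
    using assms(1) card_of_image ordLeq_ordLess_trans by blast
  moreover have "g ` I \<subseteq> Field lam"
    using assms(2) by blast
  ultimately obtain b where "b \<in> Field lam" "\<And>k. k \<in> g ` I \<Longrightarrow> k \<prec> b"
    using ex_bound by metis
  then show ?thesis
    using that by simp
qed

lemma card_of_Times_ordLess:
  assumes "|A| <o lam" and "|B| <o lam"
  shows "|A \<times> B| <o lam"
proof -
  have "stable lam"
    using regularCard_stable[OF card infinite_Field reg] .
  then show ?thesis
    using stable_elim[of lam A "\<lambda>_. B"] assms by blast
qed

text \<open>There are \<open>lam\<close> many bounds \<open>b\<close>, and each
  \<open>I \<times> underS lam b\<close> is smaller than \<open>lam\<close>, so it has at most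
  \<open>lam\<close> subsets. The factor \<open>I\<close> lets one ordinal code a whole family of
  bounded sets.\<close>

lemma ex_enumeration_bounded:
  fixes I :: "'i set"
  assumes sup: "is_card_sup (weak_powers_of_two lam) lam" and I: "|I| <o lam"
  obtains e :: "'a \<Rightarrow> ('i \<times> 'a) set" where
    "\<And>x b. b \<in> Field lam \<Longrightarrow> x \<subseteq> I \<times> underS lam b \<Longrightarrow> \<exists>a\<in>Field lam. e a = x"
proof -
  let ?B = "\<Union>b\<in>Field lam. Pow (I \<times> underS lam b)"
  have "|Pow (I \<times> underS lam b)| \<le>o lam" if "b \<in> Field lam" for b
    using card_of_Pow_ordLeq_weak_power_sup[OF card sup] card_of_Times_ordLess[OF I]
      card_of_underS[OF card that] by blast
  moreover have "|Field lam| \<le>o lam"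
    using card_of_Field_ordIso[OF card] ordIso_iff_ordLeq by blast
  ultimately have "|?B| \<le>o lam"
    by (intro card_of_UNION_ordLeq_infinite_Field[OF infinite_Field card]) auto
  then have "|?B| \<le>o |Field lam|"
    using card_of_Field_ordIso[OF card] ordIso_symmetric ordLeq_ordIso_trans by blast
  moreover have "?B \<noteq> {}"
    using infinite_Field infinite_imp_nonempty by fastforce
  ultimately obtain e where e: "e ` Field lam = ?B"
    using card_of_ordLeq2[of ?B "Field lam"] by blast
  have "\<exists>a\<in>Field lam. e a = x" if "b \<in> Field lam" "x \<subseteq> I \<times> underS lam b" for x b
  proof -
    have "x \<in> e ` Field lam"
      unfolding e using that by blast
    then show ?thesis
      by blast
  qed
  then show ?thesis
    by (rule that)
qed


end

subsection \<open>Complete and weakly normal ultrafilters\<close>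

lemma ultrafilter_on_UNIV: "ultrafilter_on X U \<Longrightarrow> ultrafilter_on UNIV U"
  unfolding ultrafilter_on_def by simp

lemma ultrafilter_not_eventually:
  "ultrafilter_on UNIV U \<Longrightarrow> \<not> eventually P U \<Longrightarrow> eventually (\<lambda>x. \<not> P x) U"
  unfolding ultrafilter_on_def by blast

lemma ultrafilter_ex: "ultrafilter_on UNIV U \<Longrightarrow> eventually P U \<Longrightarrow> \<exists>x. P x"
  unfolding ultrafilter_on_def using eventually_happens' by blast

lemma complete_filterD:
  assumes "complete_filter d U" and "|I| <o d" and "\<And>i. i \<in> I \<Longrightarrow> eventually (P i) U"
  shows "eventually (\<lambda>x. \<forall>i\<in>I. P i x) U"
proof -
  let ?A = "(\<lambda>i. {x. P i x}) ` I"
  have "|?A| <o d"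
    using assms(2) card_of_image ordLeq_ordLess_trans by blast
  moreover have "\<forall>A\<in>?A. eventually (\<lambda>x. x \<in> A) U"
    using assms(3) by simp
  ultimately have "eventually (\<lambda>x. x \<in> \<Inter>?A) U"
    using assms(1) unfolding complete_filter_def by blast
  then show ?thesis
    by simp
qed

lemma complete_filter_filtermap:
  "complete_filter d U \<Longrightarrow> complete_filter d (filtermap f U)"
  unfolding complete_filter_def[of d "filtermap f U"] eventually_filtermap
  using complete_filterD[of d U _ "\<lambda>A x. f x \<in> A"] by (auto intro: eventually_mono)

section \<open>Weak normality and its consequences for clubs\<close>

context regular_cardinal
begin

text \<open>
  In terms of the ultrapower embedding \<open>j\<close>, the class of \<open>f\<close> is \<open>sup j[\<lambda>]\<close>.
\<close>

definition weakly_normal :: "'x filter \<Rightarrow> ('x \<Rightarrow> 'a) \<Rightarrow> bool" where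
  "weakly_normal U f \<longleftrightarrow>
     ultrafilter_on UNIV U \<and>
     (\<forall>a\<in>Field lam. eventually (\<lambda>x. a \<prec> f x) U) \<and>
     (\<forall>h. eventually (\<lambda>x. h x \<prec> f x) U \<longrightarrow>
        (\<exists>b\<in>Field lam. eventually (\<lambda>x. (h x, b) \<in> lam) U))"

lemma weakly_normal_ultrafilter: "weakly_normal U f \<Longrightarrow> ultrafilter_on UNIV U"
  unfolding weakly_normal_def by blast

lemma weakly_normal_above:
  "weakly_normal U f \<Longrightarrow> a \<in> Field lam \<Longrightarrow> eventually (\<lambda>x. a \<prec> f x) U"
  unfolding weakly_normal_def by blast

lemma weakly_normal_regressive:
  assumes "weakly_normal U f" and "eventually (\<lambda>x. h x \<prec> f x) U"
  obtains b where "b \<in> Field lam" and "eventually (\<lambda>x. (h x, b) \<in> lam) U"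
  using assms unfolding weakly_normal_def by blast

lemma weakly_normal_filtermap:
  assumes "weakly_normal U f"
  shows "weakly_normal (filtermap f U) (\<lambda>a. a)"
  unfolding weakly_normal_def eventually_filtermap
proof (intro conjI allI impI)
  show "ultrafilter_on UNIV (filtermap f U)"
    using weakly_normal_ultrafilter[OF assms]
    unfolding ultrafilter_on_def by (simp add: eventually_filtermap filtermap_bot_iff)
  show "\<forall>a\<in>Field lam. eventually (\<lambda>x. a \<prec> f x) U"
    using weakly_normal_above[OF assms] by blast
  show "\<exists>b\<in>Field lam. eventually (\<lambda>x. (h (f x), b) \<in> lam) U"
    if "eventually (\<lambda>x. h (f x) \<prec> f x) U" for h
    using weakly_normal_regressive[OF assms that] by blast
qed

text \<open>
  Countable completeness makes the ultrapower well-founded, so there is a least function above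
  all constants.
\<close>

lemma ex_weakly_normal:
  assumes U: "ultrafilter_on UNIV U"
    and countable: "\<And>P :: nat \<Rightarrow> 'x \<Rightarrow> bool. (\<And>n. eventually (P n) U)
      \<Longrightarrow> eventually (\<lambda>x. \<forall>n. P n x) U"
    and g: "\<And>a. a \<in> Field lam \<Longrightarrow> eventually (\<lambda>x. a \<prec> g x) U"
  shows "\<exists>f. weakly_normal U f"
proof -
  let ?R = "{(h, g). eventually (\<lambda>x. h x \<prec> g x) U}"
  let ?Q = "{g. \<forall>a\<in>Field lam. eventually (\<lambda>x. a \<prec> g x) U}"
  \<comment> \<open>By \<open>countable\<close>, a descending sequence of functions would descend at
    a single point \<open>x\<close>.\<close>
  have "wf ?R"
    unfolding wf_iff_no_infinite_down_chain
  proof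
    assume "\<exists>F. \<forall>n. (F (Suc n), F n) \<in> ?R"
    then obtain F where "\<And>n. eventually (\<lambda>x. F (Suc n) x \<prec> F n x) U"
      by blast
    then have "eventually (\<lambda>x. \<forall>n. F (Suc n) x \<prec> F n x) U"
      by (rule countable)
    then obtain x where "\<forall>n. F (Suc n) x \<prec> F n x"
      using ultrafilter_ex[OF U] by blast
    then show False
      using wf_below unfolding wf_iff_no_infinite_down_chain by auto
  qed
  moreover have "g \<in> ?Q"
    using g by blast
  ultimately obtain f where f: "f \<in> ?Q" "\<And>h. (h, f) \<in> ?R \<Longrightarrow> h \<notin> ?Q"
    by (rule wfE_min) blast
  have "\<exists>b\<in>Field lam. eventually (\<lambda>x. (h x, b) \<in> lam) U"
    if h: "eventually (\<lambda>x. h x \<prec> f x) U" for h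
  proof -
    have "h \<notin> ?Q"
      using f(2) h by blast
    then obtain b where b: "b \<in> Field lam" "\<not> eventually (\<lambda>x. b \<prec> h x) U"
      by blast
    from ultrafilter_not_eventually[OF U b(2)] h have "eventually (\<lambda>x. (h x, b) \<in> lam) U"
      by eventually_elim (use b(1) not_below below_Field in blast)
    then show ?thesis
      using b(1) by blast
  qed
  then have "weakly_normal U f"
    unfolding weakly_normal_def using U f(1) by blast
  then show ?thesis
    by blast
qed

text \<open>
  In the ultrapower, this says that \<open>sup j[\<lambda>]\<close> is closed under any function that, for each
  \<open>b < \<lambda>\<close>, maps \<open>j(b)\<close> below some \<open>j(c)\<close> with \<open>c < \<lambda>\<close>.
\<close>

lemma weakly_normal_reflect:
  assumes wn: "weakly_normal U f"
    and step: "\<And>b. b \<in> Field lam \<Longrightarrow> \<exists>c\<in>Field lam. eventually (Q b c) U"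
    and anti: "\<And>b b' c x. (b, b') \<in> lam \<Longrightarrow> Q b' c x \<Longrightarrow> Q b c x"
  shows "eventually (\<lambda>x. \<forall>b. b \<prec> f x \<longrightarrow> (\<exists>c. c \<prec> f x \<and> Q b c x)) U"
proof (rule ccontr)
  \<comment> \<open>A failing argument \<open>h x\<close> is below \<open>f x\<close>, hence bounded
    by a constant \<open>b\<close> almost everywhere; \<open>anti\<close> then passes
    \<open>Q b c\<close> down to \<open>h x\<close>, although \<open>c \<prec> f x\<close>.\<close>
  define h where "h x = (SOME b. b \<prec> f x \<and> (\<forall>c. c \<prec> f x \<longrightarrow> \<not> Q b c x))" for x
  assume "\<not> ?thesis"
  then have "eventually (\<lambda>x. \<not> (\<forall>b. b \<prec> f x \<longrightarrow> (\<exists>c. c \<prec> f x \<and> Q b c x))) U"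
    by (rule ultrafilter_not_eventually[OF weakly_normal_ultrafilter[OF wn]])
  then have h: "eventually (\<lambda>x. h x \<prec> f x \<and> (\<forall>c. c \<prec> f x \<longrightarrow> \<not> Q (h x) c x)) U"
  proof (rule eventually_mono)
    fix x
    assume "\<not> (\<forall>b. b \<prec> f x \<longrightarrow> (\<exists>c. c \<prec> f x \<and> Q b c x))"
    then have "\<exists>b. b \<prec> f x \<and> (\<forall>c. c \<prec> f x \<longrightarrow> \<not> Q b c x)"
      by blast
    then show "h x \<prec> f x \<and> (\<forall>c. c \<prec> f x \<longrightarrow> \<not> Q (h x) c x)"
      unfolding h_def by (rule someI_ex)
  qed
  then have "eventually (\<lambda>x. h x \<prec> f x) U"
    by (rule eventually_mono) blast
  then obtain b where b: "b \<in> Field lam" "eventually (\<lambda>x. (h x, b) \<in> lam) U"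
    by (rule weakly_normal_regressive[OF wn])
  obtain c where c: "c \<in> Field lam" "eventually (Q b c) U"
    using step b(1) by blast
  from h b(2) c(2) weakly_normal_above[OF wn c(1)] have "eventually (\<lambda>x. False) U"
    by eventually_elim (use anti in blast)
  then show False
    using weakly_normal_ultrafilter[OF wn] by (auto dest: ultrafilter_ex)
qed

text \<open>Given \<open>b\<close>, regularity yields one \<open>d\<close> bounding a member above
  \<open>b\<close> of every \<open>C i\<close>. Reflection closes almost every \<open>f x\<close>
  under the passage from \<open>b\<close> to \<open>d\<close>, so a single set in \<open>U\<close>
  serves all \<open>i\<close>, instead of an intersection of \<open>|I|\<close> sets.\<close>

lemma eventually_unbounded:
  fixes I :: "'i set"
  assumes wn: "weakly_normal U f" and I: "|I| <o lam"
    and C: "\<And>i. i \<in> I \<Longrightarrow> C i \<subseteq> Field lam" "\<And>i. i \<in> I \<Longrightarrow> cofinal (C i) lam"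
  shows "eventually (\<lambda>x. \<forall>i\<in>I. \<forall>b. b \<prec> f x \<longrightarrow> (\<exists>c\<in>C i. b \<prec> c \<and> c \<prec> f x)) U"
proof -
  have "eventually (\<lambda>x. \<forall>b. b \<prec> f x \<longrightarrow>
      (\<exists>d. d \<prec> f x \<and> (\<forall>i\<in>I. \<exists>c\<in>C i. b \<prec> c \<and> (c, d) \<in> lam))) U"
  proof (rule weakly_normal_reflect[OF wn])
    fix b assume b: "b \<in> Field lam"
    have "\<forall>i\<in>I. \<exists>c\<in>C i. b \<prec> c"
      using C(2) b unfolding cofinal_def below_iff by blast
    then obtain c where c: "\<And>i. i \<in> I \<Longrightarrow> c i \<in> C i \<and> b \<prec> c i"
      by metis
    obtain d where "d \<in> Field lam" "\<And>i. i \<in> I \<Longrightarrow> c i \<prec> d"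
      using ex_image_bound[OF I, of c] c below_Field by metis
    then show "\<exists>d\<in>Field lam. eventually (\<lambda>x. \<forall>i\<in>I. \<exists>c\<in>C i. b \<prec> c \<and> (c, d) \<in> lam) U"
      using c below_imp_le by (intro bexI[of _ d] always_eventually) blast+
  next
    fix b b' d x assume "(b, b') \<in> lam" "\<forall>i\<in>I. \<exists>c\<in>C i. b' \<prec> c \<and> (c, d) \<in> lam"
    then show "\<forall>i\<in>I. \<exists>c\<in>C i. b \<prec> c \<and> (c, d) \<in> lam"
      using le_below_trans by blast
  qed
  then show ?thesis
    by (rule eventually_mono) (meson le_below_trans)
qed

lemma eventually_in_clubs:
  fixes I :: "'i set"
  assumes wn: "weakly_normal U f" and I: "|I| <o lam"
    and C: "\<And>i. i \<in> I \<Longrightarrow> club lam (C i)"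
  shows "eventually (\<lambda>x. \<forall>i\<in>I. f x \<in> C i) U"
proof -
  \<comment> \<open>A constant below \<open>f x\<close> makes \<open>underS lam (f x)\<close>
    nonempty, as \<open>closed_in\<close> demands.\<close>
  obtain a where a: "a \<in> Field lam"
    using infinite_Field infinite_imp_nonempty by blast
  have "eventually (\<lambda>x. \<forall>i\<in>I. \<forall>b. b \<prec> f x \<longrightarrow> (\<exists>c\<in>C i. b \<prec> c \<and> c \<prec> f x)) U"
    using eventually_unbounded[OF wn I] C unfolding club_def by blast
  with weakly_normal_above[OF wn a] show ?thesis
  proof eventually_elim
    case (elim x)
    show ?case
    proof
      fix i assume i: "i \<in> I"
      have "f x \<in> Field lam" "underS lam (f x) \<noteq> {}"
        using elim(1) below_Field by blast+
      moreover have "\<forall>b\<in>underS lam (f x). \<exists>c\<in>C i \<inter> underS lam (f x). b \<prec> c"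
        using elim(2) i by blast
      ultimately show "f x \<in> C i"
        using C[OF i] unfolding club_def closed_in_def by blast
    qed
  qed
qed

text \<open>By fineness, strict bounds of the small sets \<open>s\<close> dominate all constants, so
  some \<open>f\<close> represents \<open>sup j[\<lambda>]\<close>; \<open>W\<close> is the image of
  \<open>U\<close> under \<open>f\<close>. Fineness and reflection make \<open>s\<close> cofinal in
  \<open>f s\<close>, which yields the sets \<open>E\<close> of size below
  \<open>del\<close>.\<close>

lemma ex_weakly_normal_on_small_cofinality:
  fixes del :: "'d rel"
  assumes sc: "strongly_compact_upto lam del" and del: "Card_order del" "del \<le>o lam"
  obtains W :: "'a filter" where "weakly_normal W (\<lambda>a. a)" and "complete_filter del W"
    and "eventually (\<lambda>a. \<exists>E\<subseteq>underS lam a. |E| <o del \<and> (\<forall>b. b \<prec> a \<longrightarrow> (\<exists>c\<in>E. b \<prec> c))) W"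
proof -
  obtain U where U: "ultrafilter_on (P_less del lam) U" and compl: "complete_filter del U"
    and fine: "fine_filter lam U" and unc: "natLeq <o del"
    using sc unfolding strongly_compact_upto_def by blast
  have P: "eventually (\<lambda>s. s \<in> P_less del lam) U"
    using U unfolding ultrafilter_on_def le_principal by blast
  define g where "g s = (SOME b. \<forall>a\<in>s. a \<prec> b)" for s
  have g: "\<forall>a\<in>s. a \<prec> g s" if "s \<in> P_less del lam" for s
  proof -
    have "s \<subseteq> Field lam" "|s| <o lam"
      using that del(2) ordLess_ordLeq_trans unfolding P_less_def by blast+
    then obtain b where "\<forall>a\<in>s. a \<prec> b"
      using ex_bound by metis
    then show ?thesis
      unfolding g_def by (rule someI)
  qed
  have "eventually (\<lambda>s. a \<prec> g s) U" if "a \<in> Field lam" for a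
  proof -
    have "eventually (\<lambda>s. a \<in> s) U"
      using fine that unfolding fine_filter_def by blast
    with P show ?thesis
      by eventually_elim (use g in blast)
  qed
  \<comment> \<open>As \<open>natLeq <o del\<close>, \<open>del\<close>-completeness includes
    countable completeness.\<close>
  moreover have "eventually (\<lambda>x. \<forall>n. P n x) U" if "\<And>n. eventually (P n) U"
    for P :: "nat \<Rightarrow> 'a set \<Rightarrow> bool"
  proof -
    have "|UNIV :: nat set| <o del"
      using unc card_of_nat ordIso_ordLess_trans by blast
    then show ?thesis
      using complete_filterD[OF compl, of UNIV P] that by simp
  qed
  ultimately obtain f where f: "weakly_normal U f"
    using ex_weakly_normal[OF ultrafilter_on_UNIV[OF U], of g] by blast
  have "eventually (\<lambda>s. \<forall>b. b \<prec> f s \<longrightarrow> (\<exists>c. c \<prec> f s \<and> (b \<prec> c \<and> c \<in> s))) U"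
  proof (rule weakly_normal_reflect[OF f])
    fix b assume "b \<in> Field lam"
    then obtain c where c: "b \<prec> c"
      using ex_above by blast
    then have "eventually (\<lambda>s. c \<in> s) U"
      using fine below_Field unfolding fine_filter_def by blast
    then have "eventually (\<lambda>s. b \<prec> c \<and> c \<in> s) U"
      by (rule eventually_mono) (use c in blast)
    then show "\<exists>c\<in>Field lam. eventually (\<lambda>s. b \<prec> c \<and> c \<in> s) U"
      using c below_Field by blast
  qed (use le_below_trans in blast)
  with P have "eventually (\<lambda>s. \<exists>E\<subseteq>underS lam (f s). |E| <o del \<and>
      (\<forall>b. b \<prec> f s \<longrightarrow> (\<exists>c\<in>E. b \<prec> c))) U"
  proof eventually_elim
    case (elim s)
    have "|s \<inter> underS lam (f s)| <o del"
      using elim(1) card_of_mono1[of "s \<inter> underS lam (f s)" s] ordLeq_ordLess_trans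
      unfolding P_less_def by blast
    then show ?case
      using elim(2) by (intro exI[of _ "s \<inter> underS lam (f s)"]) blast
  qed
  then show ?thesis
    by (intro that[OF weakly_normal_filtermap[OF f] complete_filter_filtermap[OF compl]])
      (simp add: eventually_filtermap)
qed


lemma not_diamond_counterexample:
  assumes "\<not> diamond lam" and "\<And>a. a \<in> Field lam \<Longrightarrow> S a \<subseteq> underS lam a"
  obtains X C where "X \<subseteq> Field lam" and "club lam C"
    and "\<And>a. a \<in> C \<Longrightarrow> X \<inter> underS lam a \<noteq> S a"
proof -
  have "\<not> (\<forall>X\<subseteq>Field lam. stationary lam {a \<in> Field lam. X \<inter> underS lam a = S a})"
  proof
    assume "\<forall>X\<subseteq>Field lam. stationary lam {a \<in> Field lam. X \<inter> underS lam a = S a}"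
    then have "diamond lam"
      unfolding diamond_def using assms(2) by (intro exI[of _ S] conjI) simp_all
    with assms(1) show False
      by (rule notE)
  qed
  then obtain X where X: "X \<subseteq> Field lam"
    "\<not> stationary lam {a \<in> Field lam. X \<inter> underS lam a = S a}"
    by blast
  then obtain C where C: "club lam C" "{a \<in> Field lam. X \<inter> underS lam a = S a} \<inter> C = {}"
    unfolding stationary_def by blast
  show ?thesis
  proof (rule that[OF X(1) C(1)])
    fix a assume "a \<in> C"
    then show "X \<inter> underS lam a \<noteq> S a"
      using C unfolding club_def by blast
  qed
qed


subsection \<open>The measurable case\<close>

text \<open>\<open>A\<close> consists of the ordinals whose image under \<open>j\<close> lies in the
  class of \<open>S\<close>. Weak normality would bound disagreements \<open>h a\<close> below
  \<open>a\<close> by some \<open>b\<close>, but completeness settles the fewer than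
  \<open>lam\<close> ordinals up to \<open>b\<close> at once.\<close>

lemma eventually_coherent:
  assumes wn: "weakly_normal W (\<lambda>a. a)" and compl: "complete_filter lam W"
  shows "\<exists>A. eventually (\<lambda>a. S a \<inter> underS lam a = A \<inter> underS lam a) W"
proof -
  define A where "A = {b. eventually (\<lambda>a. b \<in> S a) W}"
  note ultra = weakly_normal_ultrafilter[OF wn]
  have "eventually (\<lambda>a. \<forall>b. b \<prec> a \<longrightarrow> (b \<in> S a \<longleftrightarrow> b \<in> A)) W"
  proof (rule ccontr)
    define h where "h a = (SOME b. b \<prec> a \<and> (b \<in> S a \<longleftrightarrow> b \<notin> A))" for a
    assume "\<not> ?thesis"
    then have "eventually (\<lambda>a. \<not> (\<forall>b. b \<prec> a \<longrightarrow> (b \<in> S a \<longleftrightarrow> b \<in> A))) W"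
      by (rule ultrafilter_not_eventually[OF ultra])
    then have h: "eventually (\<lambda>a. h a \<prec> a \<and> (h a \<in> S a \<longleftrightarrow> h a \<notin> A)) W"
    proof (rule eventually_mono)
      fix a
      assume "\<not> (\<forall>b. b \<prec> a \<longrightarrow> (b \<in> S a \<longleftrightarrow> b \<in> A))"
      then have "\<exists>b. b \<prec> a \<and> (b \<in> S a \<longleftrightarrow> b \<notin> A)"
        by blast
      then show "h a \<prec> a \<and> (h a \<in> S a \<longleftrightarrow> h a \<notin> A)"
        unfolding h_def by (rule someI_ex)
    qed
    then have "eventually (\<lambda>a. h a \<prec> a) W"
      by (rule eventually_mono) blast
    then obtain b where b: "b \<in> Field lam" "eventually (\<lambda>a. (h a, b) \<in> lam) W"
      by (rule weakly_normal_regressive[OF wn])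
    \<comment> \<open>The bound \<open>b\<close> is not strict, so agreement is established below
      some \<open>c\<close> above it.\<close>
    obtain c where c: "b \<prec> c"
      using ex_above b(1) by blast
    have "eventually (\<lambda>a. \<forall>d\<in>underS lam c. d \<in> S a \<longleftrightarrow> d \<in> A) W"
    proof (rule complete_filterD[OF compl])
      show "|underS lam c| <o lam"
        using card_of_underS[OF card] c below_Field by blast
      show "eventually (\<lambda>a. d \<in> S a \<longleftrightarrow> d \<in> A) W" for d
      proof (cases "d \<in> A")
        case True
        then show ?thesis
          unfolding A_def by simp
      next
        case False
        then have "eventually (\<lambda>a. d \<notin> S a) W"
          unfolding A_def using ultrafilter_not_eventually[OF ultra] by simp
        then show ?thesis
          by (rule eventually_mono) (use False in blast)
      qed
    qed
    with h b(2) have "eventually (\<lambda>a. False) W"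
      by eventually_elim (use c le_below_trans in blast)
    then show False
      using ultra by (auto dest: ultrafilter_ex)
  qed
  then have "eventually (\<lambda>a. S a \<inter> underS lam a = A \<inter> underS lam a) W"
    by (rule eventually_mono) blast
  then show ?thesis
    by blast
qed

text \<open>
  Jensen's argument: \<open>S a\<close> is part of a counterexample \<open>(S a, D a)\<close> below \<open>a\<close> to the guessing by
  the earlier values of \<open>S\<close>. By normality the counterexamples cohere on a set in \<open>W\<close>, so that for
  \<open>a < a'\<close> in that set, \<open>a\<close> is a limit point of \<open>D a'\<close> at which \<open>S a'\<close> is guessed.
\<close>

lemma diamond_if_complete:
  assumes wn: "weakly_normal W (\<lambda>a. a)" and compl: "complete_filter lam W"
  shows "diamond lam"
proof (rule ccontr)
  assume not_diamond: "\<not> diamond lam"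
  \<comment> \<open>The pair \<open>p\<close> consists of a set and a club in \<open>a\<close> at
    whose points \<open>S\<close> fails to guess the set.\<close>
  define bad where "bad S a p \<longleftrightarrow> fst p \<subseteq> underS lam a \<and> snd p \<subseteq> underS lam a \<and>
      (\<forall>b. b \<prec> a \<longrightarrow> (\<exists>c\<in>snd p. b \<prec> c)) \<and>
      (\<forall>b. b \<prec> a \<longrightarrow> underS lam b \<noteq> {} \<longrightarrow>
        (\<forall>c. c \<prec> b \<longrightarrow> (\<exists>d\<in>snd p. c \<prec> d \<and> d \<prec> b)) \<longrightarrow> b \<in> snd p) \<and>
      (\<forall>b\<in>snd p. fst p \<inter> underS lam b \<noteq> S b)"
    for S :: "'a \<Rightarrow> 'a set" and a and p :: "'a set \<times> 'a set"
  define P where "P F a p \<longleftrightarrow> fst p \<subseteq> underS lam a \<and>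
      ((\<exists>q. bad (\<lambda>b. fst (F b)) a q) \<longrightarrow> bad (\<lambda>b. fst (F b)) a p)"
    for F :: "'a \<Rightarrow> 'a set \<times> 'a set" and a p
  \<comment> \<open>Badness at \<open>a\<close> refers to \<open>S\<close> only below
    \<open>a\<close>, so counterexamples can be chosen by recursion; \<open>({}, {})\<close> is the
    default when there is none.\<close>
  have "\<exists>F. \<forall>a. P F a (F a)"
  proof (rule dependent_wf_choice[OF wf_below])
    fix F G :: "'a \<Rightarrow> 'a set \<times> 'a set" and a p
    assume "\<And>b. (b, a) \<in> {(b, a). b \<prec> a} \<Longrightarrow> F b = G b"
    then have FG: "\<And>b. b \<prec> a \<Longrightarrow> F b = G b"
      by blast
    have "bad (\<lambda>b. fst (F b)) a q \<longleftrightarrow> bad (\<lambda>b. fst (G b)) a q" for q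
      unfolding bad_def using FG by (intro conj_cong refl ball_cong) (simp add: subset_iff)
    then show "P F a p = P G a p"
      unfolding P_def by simp
  next
    fix a and F :: "'a \<Rightarrow> 'a set \<times> 'a set"
    show "\<exists>p. P F a p"
    proof (cases "\<exists>q. bad (\<lambda>b. fst (F b)) a q")
      case True
      then show ?thesis
        unfolding P_def bad_def by blast
    next
      case False
      then show ?thesis
        unfolding P_def by (intro exI[of _ "({}, {})"]) simp
    qed
  qed
  then obtain F where F: "\<And>a. P F a (F a)"
    by blast
  define S where "S a = fst (F a)" for a
  define D where "D a = snd (F a)" for a
  have S: "S a \<subseteq> underS lam a" for a
    using F[of a] unfolding P_def S_def by blast
  have SD: "bad S a (S a, D a)" if "bad S a q" for a q
  proof -
    have "S = (\<lambda>b. fst (F b))"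
      by (simp add: S_def fun_eq_iff)
    moreover have "(S a, D a) = F a"
      by (simp add: S_def D_def)
    ultimately show ?thesis
      using F[of a] that unfolding P_def by metis
  qed
  obtain X C where C: "club lam C" and XC: "\<And>a. a \<in> C \<Longrightarrow> X \<inter> underS lam a \<noteq> S a"
    using not_diamond_counterexample[OF not_diamond S] by metis
  have C': "C \<subseteq> Field lam" "cofinal C lam" "closed_in lam C"
    using C unfolding club_def by blast+
  \<comment> \<open>A one-element index set specialises \<open>eventually_unbounded\<close> to the
    single club \<open>C\<close>, so that \<open>(X, C)\<close> restricted to \<open>a\<close> is
    bad for almost every \<open>a\<close>.\<close>
  have "|{()}| <o lam"
    by (rule finite_ordLess_infinite[OF card_of_Well_order Well_order])
      (simp_all add: Field_card_of infinite_Field)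
  then have "eventually (\<lambda>a. \<forall>b. b \<prec> a \<longrightarrow> (\<exists>c\<in>C. b \<prec> c \<and> c \<prec> a)) W"
    using eventually_unbounded[OF wn, of "{()}" "\<lambda>_. C"] C' by simp
  then have bad: "eventually (\<lambda>a. bad S a (S a, D a)) W"
  proof (rule eventually_mono)
    fix a
    assume unb: "\<forall>b. b \<prec> a \<longrightarrow> (\<exists>c\<in>C. b \<prec> c \<and> c \<prec> a)"
    have "bad S a (X \<inter> underS lam a, C \<inter> underS lam a)"
      unfolding bad_def fst_conv snd_conv
    proof (intro conjI allI impI ballI)
      fix b
      assume b: "b \<prec> a" "underS lam b \<noteq> {}"
        "\<forall>c. c \<prec> b \<longrightarrow> (\<exists>d\<in>C \<inter> underS lam a. c \<prec> d \<and> d \<prec> b)"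
      then have "b \<in> C"
        using C'(3) below_Field(1)[OF b(1)] unfolding closed_in_def by blast
      then show "b \<in> C \<inter> underS lam a"
        using b(1) by blast
    next
      fix b assume b: "b \<in> C \<inter> underS lam a"
      then have "(X \<inter> underS lam a) \<inter> underS lam b = X \<inter> underS lam b"
        using below_trans by blast
      then show "(X \<inter> underS lam a) \<inter> underS lam b \<noteq> S b"
        using XC b by simp
    qed (use unb in auto)
    then show "bad S a (S a, D a)"
      by (rule SD)
  qed
  obtain A where A: "eventually (\<lambda>a. S a \<inter> underS lam a = A \<inter> underS lam a) W"
    using eventually_coherent[OF wn compl] by blast
  obtain B where B: "eventually (\<lambda>a. D a \<inter> underS lam a = B \<inter> underS lam a) W"
    using eventually_coherent[OF wn compl] by blast
  obtain a0 where a0: "a0 \<in> Field lam"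
    using infinite_Field infinite_imp_nonempty by blast
  \<comment> \<open>\<open>a0 \<prec> a\<close> keeps \<open>underS lam a\<close> nonempty for the
    closure clause of \<open>bad\<close>.\<close>
  define good where "good a \<longleftrightarrow> bad S a (S a, D a) \<and> S a = A \<inter> underS lam a \<and>
    D a = B \<inter> underS lam a \<and> a0 \<prec> a" for a
  from bad A B weakly_normal_above[OF wn a0] have good: "eventually good W"
  proof eventually_elim
    case (elim a)
    then have "S a \<subseteq> underS lam a" "D a \<subseteq> underS lam a"
      unfolding bad_def by simp_all
    then show ?case
      unfolding good_def using elim by (simp add: inf.absorb1)
  qed
  note ultra = weakly_normal_ultrafilter[OF wn]
  obtain a where a: "good a"
    using ultrafilter_ex[OF ultra good] by blast
  then have "a \<in> Field lam"
    unfolding good_def using below_Field by blast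
  from good weakly_normal_above[OF wn this] have "eventually (\<lambda>a'. good a' \<and> a \<prec> a') W"
    by eventually_elim blast
  then obtain a' where a': "good a'" "a \<prec> a'"
    using ultrafilter_ex[OF ultra] by blast
  have bads: "bad S a (S a, D a)" "bad S a' (S a', D a')"
    and eqs: "S a = A \<inter> underS lam a" "D a = B \<inter> underS lam a"
      "S a' = A \<inter> underS lam a'" "D a' = B \<inter> underS lam a'"
    using a a'(1) unfolding good_def by blast+
  have sub: "underS lam a \<subseteq> underS lam a'"
    using below_trans[OF _ a'(2)] by blast
  have "\<exists>d\<in>D a. c \<prec> d" if "c \<prec> a" for c
    using bads(1) that unfolding bad_def by simp
  then have "\<exists>d\<in>D a'. c \<prec> d \<and> d \<prec> a" if "c \<prec> a" for c
    using that sub unfolding eqs by blast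
  moreover have "underS lam a \<noteq> {}"
    using a unfolding good_def by blast
  ultimately have "a \<in> D a'"
    using bads(2) a'(2) unfolding bad_def by simp
  then have "S a' \<inter> underS lam a \<noteq> S a"
    using bads(2) unfolding bad_def by simp
  moreover have "S a' \<inter> underS lam a = S a"
    unfolding eqs using sub by blast
  ultimately show False
    by blast
qed


subsection \<open>The non-measurable case\<close>

text \<open>
  The sets \<open>s a\<close> represent a cover of \<open>j[\<lambda>]\<close> in the ultrapower by \<open>W\<close>. It is read off a cofinal
  subset \<open>E\<close> of \<open>sup j[\<lambda>]\<close>: there are disjoint intervals \<open>(\<beta> y, F (\<beta> y)]\<close> with \<open>y < \<lambda>\<close> such that
  \<open>E\<close> meets the image under \<open>j\<close> of each of them.
\<close>

lemma ex_fine_cover: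
  fixes del :: "'d rel"
  assumes wn: "weakly_normal W (\<lambda>a. a)"
    and cof: "eventually (\<lambda>a. \<exists>E\<subseteq>underS lam a. |E| <o del \<and>
      (\<forall>b. b \<prec> a \<longrightarrow> (\<exists>c\<in>E. b \<prec> c))) W"
  obtains s :: "'a \<Rightarrow> 'a set" where "\<And>y. y \<in> Field lam \<Longrightarrow> eventually (\<lambda>a. y \<in> s a) W"
    and "eventually (\<lambda>a. |s a| <o del) W"
proof -
  define Q where "Q a E \<longleftrightarrow> E \<subseteq> underS lam a \<and> |E| <o del \<and>
    (\<forall>b. b \<prec> a \<longrightarrow> (\<exists>c\<in>E. b \<prec> c))" for a E
  define E where "E a = (SOME E. Q a E)" for a
  have E: "eventually (\<lambda>a. Q a (E a)) W"
    using cof unfolding Q_def[symmetric] E_def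
    by (rule eventually_mono) (rule someI_ex)
  have "\<exists>c\<in>Field lam. eventually (\<lambda>a. \<exists>x\<in>E a. b \<prec> x \<and> (x, c) \<in> lam) W"
    if b: "b \<in> Field lam" for b
  proof -
    \<comment> \<open>A member of \<open>E a\<close> above \<open>b\<close> is regressive in
      \<open>a\<close>, so weak normality bounds it by a constant \<open>c\<close>, which becomes
      \<open>F b\<close>.\<close>
    define h where "h a = (SOME x. x \<in> E a \<and> b \<prec> x)" for a
    from E weakly_normal_above[OF wn b]
    have h: "eventually (\<lambda>a. h a \<in> E a \<and> b \<prec> h a \<and> h a \<prec> a) W"
    proof eventually_elim
      case (elim a)
      then have "\<exists>x. x \<in> E a \<and> b \<prec> x"
        unfolding Q_def by blast
      then have "h a \<in> E a \<and> b \<prec> h a"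
        unfolding h_def by (rule someI_ex)
      then show ?case
        using elim(1) unfolding Q_def by blast
    qed
    then have "eventually (\<lambda>a. h a \<prec> a) W"
      by (rule eventually_mono) blast
    then obtain c where c: "c \<in> Field lam" "eventually (\<lambda>a. (h a, c) \<in> lam) W"
      by (rule weakly_normal_regressive[OF wn])
    from h c(2) have "eventually (\<lambda>a. \<exists>x\<in>E a. b \<prec> x \<and> (x, c) \<in> lam) W"
      by eventually_elim blast
    then show ?thesis
      using c(1) by blast
  qed
  then have "\<exists>F. \<forall>b\<in>Field lam. F b \<in> Field lam \<and>
      eventually (\<lambda>a. \<exists>x\<in>E a. b \<prec> x \<and> (x, F b) \<in> lam) W"
    by (intro bchoice) blast
  then obtain F where F: "\<And>b. b \<in> Field lam \<Longrightarrow> F b \<in> Field lam"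
    "\<And>b. b \<in> Field lam \<Longrightarrow> eventually (\<lambda>a. \<exists>x\<in>E a. b \<prec> x \<and> (x, F b) \<in> lam) W"
    by blast
  \<comment> \<open>Each \<open>\<beta> y\<close> is chosen above all earlier right endpoints
    \<open>F (\<beta> z)\<close>, which makes the intervals disjoint; outside
    \<open>Field lam\<close> the condition is void.\<close>
  define P where "P \<beta> y r \<longleftrightarrow> (y \<in> Field lam \<longrightarrow> r \<in> Field lam \<and> (\<forall>z. z \<prec> y \<longrightarrow> F (\<beta> z) \<prec> r))"
    for \<beta> y r
  have "\<exists>\<beta>. \<forall>y. P \<beta> y (\<beta> y)"
  proof (rule dependent_wf_choice[OF wf_below])
    show "P \<beta> y r = P \<gamma> y r" if "\<And>z. (z, y) \<in> {(a, b). a \<prec> b} \<Longrightarrow> \<beta> z = \<gamma> z" for \<beta> \<gamma> y r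
      unfolding P_def using that by auto
  next
    fix y \<beta>
    assume IH: "\<And>z. (z, y) \<in> {(a, b). a \<prec> b} \<Longrightarrow> P \<beta> z (\<beta> z)"
    show "\<exists>r. P \<beta> y r"
    proof (cases "y \<in> Field lam")
      case True
      have "F (\<beta> z) \<in> Field lam" if "z \<in> underS lam y" for z
        using IH[of z] that below_Field(1)[OF that] F(1) unfolding P_def by blast
      then obtain r where "r \<in> Field lam" "\<And>z. z \<prec> y \<Longrightarrow> F (\<beta> z) \<prec> r"
        using ex_image_bound[OF card_of_underS[OF card True], of "\<lambda>z. F (\<beta> z)"] by metis
      then have "P \<beta> y r"
        unfolding P_def by blast
      then show ?thesis
        by (rule exI)
    qed (simp add: P_def)
  qed
  then obtain \<beta> where "\<And>y. P \<beta> y (\<beta> y)"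
    by blast
  then have \<beta>: "\<And>y. y \<in> Field lam \<Longrightarrow> \<beta> y \<in> Field lam" "\<And>y z. z \<prec> y \<Longrightarrow> F (\<beta> z) \<prec> \<beta> y"
    unfolding P_def using below_Field by blast+
  \<comment> \<open>\<open>R x y\<close> places \<open>x\<close> in the interval of index
    \<open>y\<close>, and \<open>p\<close> sends a point to its index; the image of
    \<open>E a\<close> under \<open>p\<close> is the cover sought.\<close>
  define R where "R x y \<longleftrightarrow> y \<in> Field lam \<and> \<beta> y \<prec> x \<and> (x, F (\<beta> y)) \<in> lam" for x y
  define p where "p x = (THE y. R x y)" for x
  have disjoint: "\<not> R x z" if "R x y" "z \<prec> y" for x y z
    using that \<beta>(2)[of z y] le_below_trans below_asym unfolding R_def by blast
  have p: "p x = y" if "R x y" for x y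
    unfolding p_def
  proof (rule the_equality)
    show "R x y"
      by (rule that)
    show "z = y" if "R x z" for z
      using disjoint below_linear that \<open>R x y\<close> unfolding R_def by blast
  qed
  have "eventually (\<lambda>a. y \<in> p ` E a) W" if "y \<in> Field lam" for y
    using F(2)[OF \<beta>(1)[OF that]]
  proof (rule eventually_mono)
    fix a assume "\<exists>x\<in>E a. \<beta> y \<prec> x \<and> (x, F (\<beta> y)) \<in> lam"
    then obtain x where x: "x \<in> E a" "\<beta> y \<prec> x" "(x, F (\<beta> y)) \<in> lam"
      by blast
    then have "R x y"
      using that by (simp add: R_def)
    then have "p x = y"
      by (rule p)
    then show "y \<in> p ` E a"
      using x(1) by (rule image_eqI[OF sym])
  qed
  moreover have "eventually (\<lambda>a. |p ` E a| <o del) W"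
    using E
  proof (rule eventually_mono)
    fix a assume "Q a (E a)"
    then show "|p ` E a| <o del"
      unfolding Q_def using card_of_image ordLeq_ordLess_trans by blast
  qed
  ultimately show ?thesis
    by (rule that)
qed

text \<open>The argument that a measurable cardinal is a strong limit: otherwise \<open>I\<close>
  injects into \<open>Pow M\<close>, and completeness fixes the image of \<open>g x\<close>. So
  \<open>g\<close> is constant on a set in \<open>W\<close>, with a value in \<open>I\<close> that
  almost every \<open>x\<close> avoids.\<close>

lemma card_of_Pow_ordLeq_incompleteness:
  fixes W :: "'x filter" and I :: "'x set set"
  assumes ultra: "ultrafilter_on UNIV W" and compl: "complete_filter (card_of I) W"
    and I: "\<And>A. A \<in> I \<Longrightarrow> eventually (\<lambda>x. x \<in> A) W" "\<not> eventually (\<lambda>x. x \<in> \<Inter>I) W"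
    and M: "|M| <o |I|"
  shows "|Pow M| \<le>o |I|"
proof (rule ccontr)
  assume contra: "\<not> |Pow M| \<le>o |I|"
  have "|I| \<le>o |Pow M|"
    using ordLeq_total[OF card_of_Well_order[of "Pow M"] card_of_Well_order[of I]] contra by blast
  then obtain \<phi> where \<phi>: "inj_on \<phi> I" "\<phi> ` I \<subseteq> Pow M"
    using card_of_ordLeq[of I "Pow M"] by blast
  define g where "g x = (SOME A. A \<in> I \<and> x \<notin> A)" for x
  from ultrafilter_not_eventually[OF ultra I(2)]
  have g: "eventually (\<lambda>x. g x \<in> I \<and> x \<notin> g x) W"
  proof (rule eventually_mono)
    fix x assume "x \<notin> \<Inter>I"
    then have "\<exists>A. A \<in> I \<and> x \<notin> A"
      by blast
    then show "g x \<in> I \<and> x \<notin> g x"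
      unfolding g_def by (rule someI_ex)
  qed
  define T where "T = {m. eventually (\<lambda>x. m \<in> \<phi> (g x)) W}"
  have "eventually (\<lambda>x. \<forall>m\<in>M. m \<in> \<phi> (g x) \<longleftrightarrow> m \<in> T) W"
  proof (rule complete_filterD[OF compl M])
    show "eventually (\<lambda>x. m \<in> \<phi> (g x) \<longleftrightarrow> m \<in> T) W" for m
    proof (cases "m \<in> T")
      case True
      then show ?thesis
        unfolding T_def by simp
    next
      case False
      then have "eventually (\<lambda>x. m \<notin> \<phi> (g x)) W"
        unfolding T_def using ultrafilter_not_eventually[OF ultra] by simp
      then show ?thesis
        by (rule eventually_mono) (use False in blast)
    qed
  qed
  with g have const: "eventually (\<lambda>x. g x \<in> I \<and> x \<notin> g x \<and> \<phi> (g x) = T \<inter> M) W"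
    by eventually_elim (use \<phi>(2) in blast)
  then obtain x0 where x0: "g x0 \<in> I" "\<phi> (g x0) = T \<inter> M"
    using ultrafilter_ex[OF ultra] by blast
  from const I(1)[OF x0(1)] have "eventually (\<lambda>x. False) W"
  proof eventually_elim
    case (elim x)
    then have "g x = g x0"
      using \<phi>(1) x0 by (metis inj_onD)
    then show ?case
      using elim by simp
  qed
  then show False
    using ultra by (auto dest: ultrafilter_ex)
qed

text \<open>
  For \<open>A \<subseteq> I \<times> \<lambda>\<close> and almost all \<open>a\<close>, the part of \<open>A\<close> below \<open>a\<close> is a union of initial parts of
  \<open>A\<close> with codes in \<open>s a\<close>. This leaves at most \<open>|I| < \<lambda>\<close> candidates, and Kunen's trick of guessing
  \<open>|I|\<close> sets at once turns such a list of candidates into a single guess.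
\<close>

lemma diamond_if_incomplete:
  fixes del :: "'d rel"
  assumes wn: "weakly_normal W (\<lambda>a. a)" and del_compl: "complete_filter del W"
    and cof: "eventually (\<lambda>a. \<exists>E\<subseteq>underS lam a. |E| <o del \<and>
      (\<forall>b. b \<prec> a \<longrightarrow> (\<exists>c\<in>E. b \<prec> c))) W"
    and del: "Card_order del" and sup: "is_card_sup (weak_powers_of_two lam) lam"
    and incompl: "\<not> complete_filter lam W"
  shows "diamond lam"
proof (rule ccontr)
  assume not_diamond: "\<not> diamond lam"
  note ultra = weakly_normal_ultrafilter[OF wn]
  define fails where "fails I \<longleftrightarrow> |I| <o lam \<and> (\<forall>A\<in>I. eventually (\<lambda>x. x \<in> A) W) \<and>
    \<not> eventually (\<lambda>x. x \<in> \<Inter>I) W" for I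
  have "card_of ` Collect fails \<noteq> {}"
    using incompl unfolding complete_filter_def fails_def by blast
  \<comment> \<open>The least size of a failing family is the degree of completeness
    \<open>\<kappa>\<close>. The same \<open>I\<close> will index the simultaneous guesses.\<close>
  then obtain I where I: "fails I" and I_min: "\<And>J. fails J \<Longrightarrow> |I| \<le>o |J|"
    using exists_minim_Card_order[of "card_of ` Collect fails"] card_of_Card_order by auto
  have I_card: "|I| <o lam" and I_W: "\<And>A. A \<in> I \<Longrightarrow> eventually (\<lambda>x. x \<in> A) W"
    "\<not> eventually (\<lambda>x. x \<in> \<Inter>I) W"
    using I unfolding fails_def by blast+
  have I_compl: "complete_filter (card_of I) W"
    unfolding complete_filter_def
  proof (intro allI impI)
    fix J assume J: "|J| <o |I| \<and> (\<forall>A\<in>J. eventually (\<lambda>x. x \<in> A) W)"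
    then have "\<not> fails J" "|J| <o lam"
      using I_min not_ordLess_ordLeq I_card ordLess_transitive by blast+
    then show "eventually (\<lambda>x. x \<in> \<Inter>J) W"
      unfolding fails_def using J by blast
  qed
  have "\<not> |I| <o del"
    using del_compl I_W unfolding complete_filter_def by blast
  then have del_I: "del \<le>o |I|"
    using del card_of_Well_order not_ordLess_iff_ordLeq unfolding card_order_on_def by blast
  obtain s where s: "\<And>y. y \<in> Field lam \<Longrightarrow> eventually (\<lambda>a. y \<in> s a) W"
    "eventually (\<lambda>a. |s a| <o del) W"
    using ex_fine_cover[OF wn cof] by metis
  obtain e :: "'a \<Rightarrow> ('a set \<times> 'a) set" where
    e: "\<And>x b. b \<in> Field lam \<Longrightarrow> x \<subseteq> I \<times> underS lam b \<Longrightarrow> \<exists>a\<in>Field lam. e a = x"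
    using ex_enumeration_bounded[OF sup I_card] by metis
  \<comment> \<open>The strong limit property lets \<open>I\<close> enumerate all sets of codes from
    \<open>s a\<close>, each of which is a candidate at \<open>a\<close>.\<close>
  define k where "k a = (SOME k. k ` I = Pow (s a))" for a
  have k: "eventually (\<lambda>a. k a ` I = Pow (s a)) W"
    using s(2)
  proof (rule eventually_mono)
    fix a assume "|s a| <o del"
    then have "|Pow (s a)| \<le>o |I|"
      using card_of_Pow_ordLeq_incompleteness[OF ultra I_compl I_W] del_I ordLess_ordLeq_trans
      by blast
    then have "\<exists>k. k ` I = Pow (s a)"
      using card_of_ordLeq2[of "Pow (s a)" I] by blast
    then show "k a ` I = Pow (s a)"
      unfolding k_def by (rule someI_ex)
  qed
  \<comment> \<open>The \<open>i\<close>-th guess is the \<open>i\<close>-th section of the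
    \<open>i\<close>-th candidate.\<close>
  define S where "S i a = {b \<in> underS lam a. (i, b) \<in> \<Union>(e ` k a i)}" for i a
  have "\<exists>X C. X \<subseteq> Field lam \<and> club lam C \<and> (\<forall>a\<in>C. X \<inter> underS lam a \<noteq> S i a)" for i
  proof -
    have "S i a \<subseteq> underS lam a" for a
      unfolding S_def by blast
    then show ?thesis
      by (rule not_diamond_counterexample[OF not_diamond]) blast
  qed
  then obtain X C where C: "\<And>i. club lam (C i)"
    and XC: "\<And>i a. a \<in> C i \<Longrightarrow> X i \<inter> underS lam a \<noteq> S i a"
    by metis
  \<comment> \<open>One bounded set, hence one code, holds the parts of all \<open>X i\<close> below
    \<open>c\<close>.\<close>
  define cut where "cut c = {(i, b). i \<in> I \<and> b \<in> X i \<and> b \<prec> c}" for c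
  have cuts: "eventually (\<lambda>a. \<forall>b. b \<prec> a \<longrightarrow> (\<exists>c. c \<prec> a \<and> (b \<prec> c \<and> cut c \<in> e ` s a))) W"
  proof (rule weakly_normal_reflect[OF wn])
    fix b assume "b \<in> Field lam"
    then obtain c where c: "b \<prec> c" "c \<in> Field lam"
      using ex_above below_Field by blast
    then obtain y where y: "y \<in> Field lam" "e y = cut c"
      using e[of c "cut c"] unfolding cut_def by auto
    from s(1)[OF y(1)] have "eventually (\<lambda>a. b \<prec> c \<and> cut c \<in> e ` s a) W"
      by (rule eventually_mono) (use c y(2) in blast)
    then show "\<exists>c\<in>Field lam. eventually (\<lambda>a. b \<prec> c \<and> cut c \<in> e ` s a) W"
      using c by blast
  qed (use le_below_trans in blast)
  \<comment> \<open>Almost every \<open>a\<close> lies in all the clubs \<open>C i\<close> at once;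
    the \<open>i\<close> whose candidate is \<open>cut a\<close> then guesses \<open>X i\<close> at
    \<open>a\<close>, against the choice of \<open>C i\<close>.\<close>
  from cuts k eventually_in_clubs[OF wn I_card, of C, OF C]
  have "eventually (\<lambda>a. False) W"
  proof eventually_elim
    case (elim a)
    define Y where "Y = {y \<in> s a. \<exists>c. c \<prec> a \<and> e y = cut c}"
    have cut_mono: "cut c \<subseteq> cut a" if "c \<prec> a" for c
      unfolding cut_def using that below_trans by blast
    have cut_a: "cut a = \<Union>(e ` Y)"
    proof
      show "\<Union>(e ` Y) \<subseteq> cut a"
        unfolding Y_def using cut_mono by blast
      show "cut a \<subseteq> \<Union>(e ` Y)"
      proof
        fix q assume "q \<in> cut a"
        then obtain i b where q: "q = (i, b)" "i \<in> I" "b \<in> X i" "b \<prec> a"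
          unfolding cut_def by blast
        then obtain c where c: "c \<prec> a" "b \<prec> c" "cut c \<in> e ` s a"
          using elim(1) by blast
        then have "q \<in> cut c"
          using q unfolding cut_def by blast
        then show "q \<in> \<Union>(e ` Y)"
          unfolding Y_def using c by blast
      qed
    qed
    have "Y \<in> k a ` I"
      unfolding elim(2) Y_def by blast
    then obtain i where i: "i \<in> I" "k a i = Y"
      by blast
    have "X i \<inter> underS lam a = S i a"
      unfolding S_def i(2) cut_a[symmetric] using i(1) unfolding cut_def by blast
    then show False
      using XC elim(3) i(1) by blast
  qed
  then show False
    using ultra by (auto dest: ultrafilter_ex)
qed

end

theorem theorem2p4:
  fixes lam :: "'a rel" and del :: "'d rel"
  assumes "Card_order lam" and "cinfinite lam" and "regularCard lam"
    and "is_card_sup (weak_powers_of_two lam) lam"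
    and "Card_order del" and "del \<le>o lam" and "strongly_compact_upto lam del"
  shows "diamond lam"
proof -
  interpret regular_cardinal lam
    using assms(1-3) by unfold_locales
  obtain W where W: "weakly_normal W (\<lambda>a. a)" "complete_filter del W"
    "eventually (\<lambda>a. \<exists>E\<subseteq>underS lam a. |E| <o del \<and>
      (\<forall>b. b \<in> underS lam a \<longrightarrow> (\<exists>c\<in>E. b \<in> underS lam c))) W"
    by (rule ex_weakly_normal_on_small_cofinality[OF assms(7,5,6)])
  show ?thesis
  proof (cases "complete_filter lam W")
    case True
    then show ?thesis
      by (rule diamond_if_complete[OF W(1)])
  next
    case False
    then show ?thesis
      by (rule diamond_if_incomplete[OF W assms(5,4)])
  qed
qed

end
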